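(* For every integer $n \ge 0$, $|\mathfrak{D}^4_{2n}(1324)| = 2\binom{n}{2}+1 = n^2-n+1$.
   Context: A permutation $\pi$ of $[N]=\{1,\dots,N\}$ is written as $\pi(1)\pi(2)\cdots\pi(N)$. A Dumont permutation of the fourth kind (Dumont-4 permutation) of size $2n$ is a permutation $\pi$ of $[2n]$ in which all deficiencies are even values at even positions: for all $1\le i\le 2n$, if $\pi(i)<i$ then both $i$ and $\pi(i)$ are even. The set of these is $\mathfrak{D}^4_{2n}$ (for $n=0$ it consists of the empty permutation). A permutation $\pi$ of $[N]$ contains a pattern $\tau\in S_k$ if there are indices $i_1<\dots<i_k$ such that for all $a,b$, $\pi(i_a)<\pi(i_b)$ if and only if $\tau(a)<\tau(b)$; otherwise $\pi$ avoids $\tau$. $\mathfrak{D}^4_{2n}(\tau)$ denotes the set of permutations in $\mathfrak{D}^4_{2n}$ avoiding $\tau$. *)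

theory Defs
  imports Main "HOL-Combinatorics.Permutations"
begin

text \<open>
  A permutation of \<open>[N] = {1, \<dots>, N}\<close> is a function \<open>p\<close> with \<open>p permutes {1..N}\<close>: it is bijective
  on \<open>{1..N}\<close> and the identity elsewhere, so distinct functions are distinct permutations
  of \<open>[N]\<close>, and for \<open>N = 0\<close> the empty permutation is represented by \<open>id\<close>.
\<close>

text \<open>
  The function whose one-line notation is the given list, with positions counted from 1.
\<close>

definition one_line :: "nat list \<Rightarrow> nat \<Rightarrow> nat" where
  "one_line xs i = (if i \<in> {1..length xs} then xs ! (i - 1) else i)"

definition dumont4 :: "nat \<Rightarrow> (nat \<Rightarrow> nat) set" where
  "dumont4 n = {p. p permutes {1..2 * n} \<and>
     (\<forall>i\<in>{1..2 * n}. p i < i \<longrightarrow> even i \<and> even (p i))}"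

text \<open>
  The permutation \<open>p\<close> of \<open>[N]\<close> contains the pattern \<open>t\<close>, a permutation of \<open>[k]\<close>;
  \<open>f a\<close> is the index \<open>i\<^sub>a\<close> of the occurrence.
\<close>

definition contains_pattern :: "nat \<Rightarrow> (nat \<Rightarrow> nat) \<Rightarrow> nat \<Rightarrow> (nat \<Rightarrow> nat) \<Rightarrow> bool" where
  "contains_pattern N p k t \<longleftrightarrow>
     (\<exists>f :: nat \<Rightarrow> nat. strict_mono_on {1..k} f \<and> f ` {1..k} \<subseteq> {1..N} \<and>
        (\<forall>a\<in>{1..k}. \<forall>b\<in>{1..k}. p (f a) < p (f b) \<longleftrightarrow> t a < t b))"

definition dumont4_avoiding :: "nat \<Rightarrow> nat \<Rightarrow> (nat \<Rightarrow> nat) \<Rightarrow> (nat \<Rightarrow> nat) set" where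
  "dumont4_avoiding n k t = {p \<in> dumont4 n. \<not> contains_pattern (2 * n) p k t}"

end

theory Submission
  imports Defs
begin

text \<open>
  Write \<open>N = 2n\<close>. The value 1 of a Dumont-4 permutation is odd, hence not the value of a
  deficiency, so it stands at position 1. In a permutation that starts with 1, avoiding 1324 means
  that the remaining entries avoid 213: if \<open>b < c < d\<close> and \<open>p b < p d\<close>, then \<open>p b < p c\<close>
  (\<open>avoider_no_213\<close>). Two large entries near the end then force almost everything to be
  increasing.

  If \<open>p N = N\<close>, the role of \<open>d\<close> is played by \<open>N\<close>, and \<open>p\<close> is the identity. Otherwise
  \<open>m = p N\<close> is the value of a deficiency, so it is even and \<open>2 \<le> m \<le> N - 2\<close>. Position \<open>N - 1\<close> is
  odd, so it carries \<open>N - 1\<close> or \<open>N\<close>; with \<open>d = N - 1\<close> one sees that all entries other than \<open>m\<close>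
  and \<open>N\<close> increase. Hence \<open>p\<close> is determined by \<open>m\<close> and by the position \<open>j\<close> of \<open>N\<close>. If \<open>j < m\<close>
  held, then the entry right after \<open>N\<close> would be \<open>p (j + 1) = j\<close>, a deficiency with a position and
  a value of different parity. So \<open>m \<le> j < N\<close>, and \<open>p\<close> is
  \<open>1 \<dots> (m-1) (m+1) \<dots> j N (j+1) \<dots> (N-1) m\<close>, called \<open>max_at N m j\<close> below. Conversely, each of these permutations has its only deficiency at
  position \<open>N\<close>, and its descents among the first \<open>N - 1\<close> positions all start at the maximum, so
  they cannot be the middle of a 1324. There are \<open>2n - 2k\<close> choices of \<open>j\<close> for \<open>m = 2k\<close>, which
  gives \<open>n (n - 1)\<close> permutations besides the identity.
\<close>

section \<open>Occurrences of 1324\<close>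

lemma contains_1324_iff:
  "contains_pattern N p 4 (one_line [1, 3, 2, 4]) \<longleftrightarrow>
     (\<exists>a b c d. 1 \<le> a \<and> a < b \<and> b < c \<and> c < d \<and> d \<le> N \<and> p a < p c \<and> p c < p b \<and> p b < p d)"
  (is "?L \<longleftrightarrow> ?R")
proof -
  have I4: "{1..4} = {1, 2, 3, 4::nat}"
    by auto
  have t: "one_line [1, 3, 2, 4] 1 = 1" "one_line [1, 3, 2, 4] 2 = 3"
    "one_line [1, 3, 2, 4] 3 = 2" "one_line [1, 3, 2, 4] 4 = 4"
    by (simp_all add: one_line_def)
  show ?thesis
  proof
    assume ?L
    then obtain f :: "nat \<Rightarrow> nat" where sm: "strict_mono_on {1..4} f" and im: "f ` {1..4} \<subseteq> {1..N}"
      and ord: "\<forall>a\<in>{1..4}. \<forall>b\<in>{1..4}.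
        p (f a) < p (f b) \<longleftrightarrow> one_line [1, 3, 2, 4] a < one_line [1, 3, 2, 4] b"
      unfolding contains_pattern_def by blast
    have "f 1 < f 2" "f 2 < f 3" "f 3 < f 4"
      using sm by (auto simp: strict_mono_on_def)
    moreover have "1 \<le> f 1" "f 4 \<le> N"
      using im unfolding image_subset_iff I4 by simp_all
    moreover have "p (f 1) < p (f 3)"
      using ord[rule_format, of 1 3] t by simp
    moreover have "p (f 3) < p (f 2)"
      using ord[rule_format, of 3 2] t by simp
    moreover have "p (f 2) < p (f 4)"
      using ord[rule_format, of 2 4] t by simp
    ultimately show ?R
      by blast
  next
    assume ?R
    then obtain a b c d where h: "1 \<le> a" "a < b" "b < c" "c < d" "d \<le> N"
      "p a < p c" "p c < p b" "p b < p d"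
      by blast
    define f where "f x = (if x = 1 then a else if x = 2 then b else if x = 3 then c else d)"
      for x :: nat
    have f: "f 1 = a" "f 2 = b" "f 3 = c" "f 4 = d"
      by (simp_all add: f_def)
    have "strict_mono_on {1..4} f"
      unfolding strict_mono_on_def I4 using h f by auto
    moreover have "f ` {1..4} \<subseteq> {1..N}"
      unfolding I4 using h f by auto
    moreover have "\<forall>x\<in>{1..4}. \<forall>y\<in>{1..4}.
        p (f x) < p (f y) \<longleftrightarrow> one_line [1, 3, 2, 4] x < one_line [1, 3, 2, 4] y"
      unfolding I4 using h by (simp only: ball_simps f t) auto
    ultimately show ?L
      unfolding contains_pattern_def by blast
  qed
qed

lemma dumont4_avoiding_1324_iff:
  "p \<in> dumont4_avoiding n 4 (one_line [1, 3, 2, 4]) \<longleftrightarrow>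
     p permutes {1..2 * n} \<and>
     (\<forall>i\<in>{1..2 * n}. p i < i \<longrightarrow> even i \<and> even (p i)) \<and>
     (\<nexists>a b c d. 1 \<le> a \<and> a < b \<and> b < c \<and> c < d \<and> d \<le> 2 * n \<and>
        p a < p c \<and> p c < p b \<and> p b < p d)"
  unfolding dumont4_avoiding_def dumont4_def contains_1324_iff by blast

section \<open>The extremal family\<close>

definition max_at :: "nat \<Rightarrow> nat \<Rightarrow> nat \<Rightarrow> nat \<Rightarrow> nat" where
  "max_at N m j i =
     (if i = N then m else if i = j then N else if m \<le> i \<and> i < j then i + 1 else i)"

lemma max_at_permutes:
  assumes "1 \<le> m" "m \<le> j" "j < N"
  shows "max_at N m j permutes {1..N}"
proof (rule bij_imp_permutes)
  have inj: "inj_on (max_at N m j) {1..N}"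
    using assms by (auto simp: inj_on_def max_at_def split: if_splits)
  have "max_at N m j ` {1..N} \<subseteq> {1..N}"
    using assms by (auto simp: max_at_def)
  then have "max_at N m j ` {1..N} = {1..N}"
    by (intro endo_inj_surj inj) auto
  with inj show "bij_betw (max_at N m j) {1..N} {1..N}"
    by (simp add: bij_betw_def)
  show "max_at N m j i = i" if "i \<notin> {1..N}" for i
    using that assms by (auto simp: max_at_def)
qed

lemma max_at_in_avoiders:
  assumes "1 \<le> k" "2 * k \<le> j" "j < 2 * n"
  shows "max_at (2 * n) (2 * k) j \<in> dumont4_avoiding n 4 (one_line [1, 3, 2, 4])"
  unfolding dumont4_avoiding_1324_iff
proof (intro conjI ballI impI notI)
  let ?q = "max_at (2 * n) (2 * k) j"
  show "?q permutes {1..2 * n}"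
    using assms by (intro max_at_permutes) auto
  fix i
  assume "i \<in> {1..2 * n}" "?q i < i"
  then show "even i" "even (?q i)"
    using assms by (auto simp: max_at_def split: if_splits)
next
  let ?q = "max_at (2 * n) (2 * k) j"
  assume "\<exists>a b c d. 1 \<le> a \<and> a < b \<and> b < c \<and> c < d \<and> d \<le> 2 * n \<and>
    ?q a < ?q c \<and> ?q c < ?q b \<and> ?q b < ?q d"
  then obtain a b c d where h: "1 \<le> a" "a < b" "b < c" "c < d" "d \<le> 2 * n"
    "?q a < ?q c" "?q c < ?q b" "?q b < ?q d"
    by blast
  have "b = j"
    using h(3-5,7) by (auto simp: max_at_def split: if_splits)
  then have "?q b = 2 * n"
    using assms by (simp add: max_at_def)
  moreover have "?q d \<le> 2 * n"
    using h assms by (auto simp: max_at_def)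
  ultimately show False
    using h(8) by simp
qed

text \<open>
  The parameters can be read off: \<open>m\<close> is the last value and \<open>j\<close> the position of \<open>N\<close>.
\<close>

lemma max_at_inj:
  assumes eq: "max_at N m j = max_at N m' j'" and "m \<le> j" "j < N" "m' \<le> j'" "j' < N"
  shows "m = m' \<and> j = j'"
proof
  show "m = m'"
    using fun_cong[OF eq, of N] by (simp add: max_at_def)
  show "j = j'"
    using fun_cong[OF eq, of j] assms(2-) by (auto simp: max_at_def split: if_splits)
qed

section \<open>Structure of the avoiders\<close>

lemma strict_mono_self_map_eq_id:
  fixes g :: "nat \<Rightarrow> nat"
  assumes mono: "strict_mono_on {1..K} g" and range: "g ` {1..K} \<subseteq> {1..K}" and i: "i \<in> {1..K}"
  shows "g i = i"
proof -
  have lower: "i \<in> {1..K} \<Longrightarrow> i \<le> g i" for i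
  proof (induction i)
    case (Suc i)
    show ?case
    proof (cases "i = 0")
      case True
      then show ?thesis
        using Suc.prems range unfolding image_subset_iff by simp
    next
      case False
      then have "i \<le> g i" "g i < g (Suc i)"
        using Suc mono by (auto simp: strict_mono_on_def)
      then show ?thesis
        by simp
    qed
  qed simp
  have upper: "k < K \<Longrightarrow> g (K - k) \<le> K - k" for k
  proof (induction k)
    case 0
    then show ?case
      using range unfolding image_subset_iff by simp
  next
    case (Suc k)
    then have "g (K - Suc k) < g (K - k)"
      by (intro strict_mono_onD[OF mono]) auto
    then show ?case
      using Suc by simp
  qed
  have "K - (K - i) = i" "K - i < K"
    using i by auto
  then show ?thesis
    using lower[OF i] upper[of "K - i"] by simp
qed

lemma avoider_first:
  assumes p: "p \<in> dumont4_avoiding n 4 (one_line [1, 3, 2, 4])" and "1 \<le> n"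
  shows "p 1 = 1"
proof -
  have perm: "p permutes {1..2 * n}"
    and dum: "\<And>i. i \<in> {1..2 * n} \<Longrightarrow> p i < i \<Longrightarrow> even (p i)"
    using p unfolding dumont4_avoiding_1324_iff by blast+
  have "1 \<in> p ` {1..2 * n}"
    using permutes_image[OF perm] assms(2) by simp
  then obtain i where i: "i \<in> {1..2 * n}" "p i = 1"
    by (metis imageE)
  then have "\<not> 1 < i"
    using dum[of i] by auto
  then show ?thesis
    using i by (cases "i = 1") auto
qed

text \<open>
  The leading 1 serves as the smallest entry of a 1324, so a 213 anywhere after it is forbidden.
\<close>

lemma avoider_no_213:
  assumes p: "p \<in> dumont4_avoiding n 4 (one_line [1, 3, 2, 4])"
    and "1 \<le> b" "b < c" "c < d" "d \<le> 2 * n" "p b < p d"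
  shows "p b < p c"
proof (rule ccontr)
  assume "\<not> p b < p c"
  have perm: "p permutes {1..2 * n}"
    using p unfolding dumont4_avoiding_1324_iff by blast
  have neq: "p x \<noteq> p y" if "x \<noteq> y" for x y
    using permutes_inj[OF perm] that by (auto dest: injD)
  have p1: "p 1 = 1"
    using avoider_first[OF p] assms by simp
  have "p c \<in> {1..2 * n}"
    using permutes_in_image[OF perm, of c] assms by simp
  then have "p 1 < p c"
    using neq[of 1 c] p1 assms by (simp add: less_le)
  moreover have cb: "p c < p b"
    using \<open>\<not> p b < p c\<close> neq[of b c] assms by simp
  moreover have "1 < b"
    using cb \<open>p 1 < p c\<close> assms by (cases "b = 1") auto
  ultimately show False
    using p assms unfolding dumont4_avoiding_1324_iff by blast
qed

lemma avoider_fixing_last_eq_id: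
  assumes p: "p \<in> dumont4_avoiding n 4 (one_line [1, 3, 2, 4])" and last: "p (2 * n) = 2 * n"
  shows "p = id"
proof
  fix i
  have perm: "p permutes {1..2 * n}"
    using p unfolding dumont4_avoiding_1324_iff by blast
  have less: "p b < 2 * n" if "b \<in> {1..<2 * n}" for b
  proof -
    have "p b \<noteq> p (2 * n)"
      using permutes_inj[OF perm] that by (auto dest: injD)
    then show ?thesis
      using permutes_in_image[OF perm, of b] that last by auto
  qed
  have "strict_mono_on {1..2 * n} p"
  proof (rule strict_mono_onI)
    fix b c
    assume bc: "b \<in> {1..2 * n}" "c \<in> {1..2 * n}" "b < c"
    show "p b < p c"
    proof (cases "c = 2 * n")
      case True
      then show ?thesis
        using less[of b] bc last by simp
    next
      case False
      then show ?thesis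
        using avoider_no_213[OF p, of b c "2 * n"] less[of b] bc last by simp
    qed
  qed
  then have "i \<in> {1..2 * n} \<Longrightarrow> p i = i"
    using strict_mono_self_map_eq_id[of "2 * n" p i] permutes_image[OF perm] by simp
  then show "p i = id i"
    using permutes_not_in[OF perm, of i] by auto
qed

text \<open>
  Deleting \<open>m\<close> and \<open>N\<close> leaves an increasing word, by comparison with position \<open>N - 1\<close>; the parity
  condition on the entries after \<open>N\<close> then yields \<open>m \<le> j\<close>.
\<close>

lemma avoider_moving_last_eq_max_at:
  assumes p: "p \<in> dumont4_avoiding n 4 (one_line [1, 3, 2, 4])" and last: "p (2 * n) \<noteq> 2 * n"
  shows "\<exists>k j. 1 \<le> k \<and> k < n \<and> 2 * k \<le> j \<and> j < 2 * n \<and> p = max_at (2 * n) (2 * k) j"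
proof -
  define N where "N = 2 * n"
  define m where "m = p N"
  have perm: "p permutes {1..N}"
    and dum: "\<And>i. i \<in> {1..N} \<Longrightarrow> p i < i \<Longrightarrow> even i \<and> even (p i)"
    using p unfolding dumont4_avoiding_1324_iff N_def by blast+
  have neq: "p x \<noteq> p y" if "x \<noteq> y" for x y
    using permutes_inj[OF perm] that by (auto dest: injD)
  have rng: "1 \<le> p x" "p x \<le> N" if "1 \<le> x" "x \<le> N" for x
    using permutes_in_image[OF perm, of x] that by simp_all
  have "n \<noteq> 0"
    using last permutes_not_in[OF perm, of 0] by (cases n) (auto simp: N_def)
  then have N2: "2 \<le> N" and evN: "even N"
    by (simp_all add: N_def)
  have p1: "p 1 = 1"
    using avoider_first[OF p] \<open>n \<noteq> 0\<close> by simp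
  have mN: "m < N" and mne1: "m \<noteq> 1" and m1: "1 \<le> m"
    using last rng[of N] neq[of 1 N] N2 p1 by (auto simp: m_def N_def)
  have evm: "even m"
    using dum[of N] mN N2 by (simp add: m_def)
  have m2: "m \<le> N - 2" and m2': "2 \<le> m"
    using evm evN mN m1 mne1 by presburger+
  have "N \<in> p ` {1..N}"
    using permutes_image[OF perm] N2 by simp
  then obtain j where j: "1 \<le> j" "j \<le> N" "p j = N"
    by (metis imageE atLeastAtMost_iff)
  have jN: "j < N"
    using j mN by (cases "j = N") (auto simp: m_def)
  have val: "1 \<le> p i" "p i < N" "p i \<noteq> m" if "1 \<le> i" "i < N" "i \<noteq> j" for i
    using rng[of i] neq[of i j] neq[of i N] that j by (auto simp: m_def)
  \<comment> \<open>Position \<open>N - 1\<close> is odd, hence not a deficiency.\<close>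
  have pen: "N - 1 \<le> p (N - 1)"
    using dum[of "N - 1"] evN N2 by (cases "p (N - 1) < N - 1") auto
  have below: "p b < p (N - 1)" if "1 \<le> b" "b < N - 1" "b \<noteq> j" for b
  proof -
    have "b < N" "b \<noteq> N - 1"
      using that by simp_all
    then show ?thesis
      using val(2)[of b] neq[of b "N - 1"] that pen by linarith
  qed
  have mono: "p b < p c" if "1 \<le> b" "b < c" "c < N" "b \<noteq> j" "c \<noteq> j" for b c
  proof (cases "c = N - 1")
    case True
    then show ?thesis
      using below[of b] that by simp
  next
    case False
    then show ?thesis
      using avoider_no_213[OF p, of b c "N - 1"] below[of b] that by (simp add: N_def)
  qed
  \<comment> \<open>Relabel positions and values by skipping position \<open>j\<close> and value \<open>m\<close>: what remains
    is an increasing self-map of an initial segment.\<close>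
  define s where "s i = (if i < j then i else i + 1)" for i
  define t where "t v = (if v < m then v else v - 1)" for v
  define g where "g i = t (p (s i))" for i
  have s: "1 \<le> s i" "s i < N" "s i \<noteq> j" if "i \<in> {1..N - 2}" for i
    using that by (auto simp: s_def)
  have s_mono: "s x < s y" if "x < y" for x y
    using that by (auto simp: s_def)
  have t_mono: "t x < t y" if "x < y" "x \<noteq> m" "y \<noteq> m" for x y
    using that by (auto simp: t_def)
  have "strict_mono_on {1..N - 2} g"
  proof (rule strict_mono_onI)
    fix x y
    assume xy: "x \<in> {1..N - 2}" "y \<in> {1..N - 2}" "x < y"
    show "g x < g y"
      unfolding g_def
    proof (rule t_mono)
      show "p (s x) < p (s y)"
        using s[OF xy(1)] s[OF xy(2)] s_mono[OF xy(3)] by (intro mono) auto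
      show "p (s x) \<noteq> m" "p (s y) \<noteq> m"
        using val(3) s xy by blast+
    qed
  qed
  moreover have "g ` {1..N - 2} \<subseteq> {1..N - 2}"
  proof
    fix y
    assume "y \<in> g ` {1..N - 2}"
    then obtain x where x: "x \<in> {1..N - 2}" "y = g x"
      by blast
    have "1 \<le> p (s x)" "p (s x) < N" "p (s x) \<noteq> m"
      using val[of "s x"] s[OF x(1)] by auto
    then show "y \<in> {1..N - 2}"
      using x(2) m2 m1 by (auto simp: g_def t_def)
  qed
  ultimately have gid: "g i = i" if "i \<in> {1..N - 2}" for i
    using strict_mono_self_map_eq_id[of "N - 2" g i] that by simp
  have mj: "m \<le> j"
  proof (rule ccontr)
    assume "\<not> m \<le> j"
    then have jm: "j < m"
      by simp
    then have "j \<in> {1..N - 2}"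
      using m2 j by auto
    then have "t (p (j + 1)) = j" "p (j + 1) \<noteq> m"
      using gid[of j] val(3)[of "j + 1"] jm mN by (auto simp: g_def s_def)
    then have "p (j + 1) = j"
      using jm by (auto simp: t_def split: if_splits)
    then have "even (j + 1) \<and> even j"
      using dum[of "j + 1"] jm mN by simp
    then show False
      by simp
  qed
  have "p = max_at N m j"
  proof
    fix i
    consider "i \<notin> {1..N}" | "i = N" | "i = j" | "1 \<le> i" "i < j" | "j < i" "i < N"
      using jN by fastforce
    then show "p i = max_at N m j i"
    proof cases
      case 1
      then show ?thesis
        using permutes_not_in[OF perm 1] mj jN m1 j by (auto simp: max_at_def)
    next
      case 2
      then show ?thesis
        by (simp add: max_at_def m_def)
    next
      case 3
      then show ?thesis
        using j jN by (simp add: max_at_def)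
    next
      case 4
      then have "t (p i) = i" "p i \<noteq> m"
        using gid[of i] val(3)[of i] jN by (auto simp: g_def s_def)
      then show ?thesis
        using 4 jN by (auto simp: max_at_def t_def split: if_splits)
    next
      case 5
      have "s (i - 1) = i" "i - 1 \<in> {1..N - 2}"
        using 5 j by (auto simp: s_def)
      then have "t (p i) = i - 1" "p i \<noteq> m"
        using gid[of "i - 1"] val(3)[of i] 5 j by (simp_all add: g_def)
      then show ?thesis
        using 5 mj m1 by (auto simp: max_at_def t_def split: if_splits)
    qed
  qed
  moreover obtain k where "m = 2 * k"
    using evm by blast
  ultimately show ?thesis
    using mj jN mN m2' unfolding N_def by (intro exI[of _ k] exI[of _ j]) auto
qed

lemma id_in_avoiders: "id \<in> dumont4_avoiding n 4 (one_line [1, 3, 2, 4])"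
  unfolding dumont4_avoiding_1324_iff by (auto simp: permutes_id)

lemma avoiders_eq:
  "dumont4_avoiding n 4 (one_line [1, 3, 2, 4]) =
     insert id ((\<lambda>(k, j). max_at (2 * n) (2 * k) j) ` (SIGMA k:{1..<n}. {2 * k..<2 * n}))"
  (is "?A = insert id (?F ` ?I)")
proof (intro subset_antisym subsetI)
  fix p
  assume p: "p \<in> ?A"
  show "p \<in> insert id (?F ` ?I)"
  proof (cases "p (2 * n) = 2 * n")
    case True
    then show ?thesis
      using avoider_fixing_last_eq_id[OF p] by simp
  next
    case False
    then obtain k j where "1 \<le> k" "k < n" "2 * k \<le> j" "j < 2 * n" "p = ?F (k, j)"
      using avoider_moving_last_eq_max_at[OF p] by auto
    moreover from this have "(k, j) \<in> ?I"
      by simp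
    ultimately show ?thesis
      by blast
  qed
next
  fix p
  assume "p \<in> insert id (?F ` ?I)"
  then show "p \<in> ?A"
    using id_in_avoiders max_at_in_avoiders by auto
qed

section \<open>Counting\<close>

lemma sum_even_differences: "(\<Sum>k\<in>{1..<n}. 2 * n - 2 * k) = n * (n - 1)" for n :: nat
proof (induction n)
  case (Suc n)
  have "(\<Sum>k\<in>{1..<Suc n}. 2 * Suc n - 2 * k) = (\<Sum>k\<in>{1..<Suc n}. (2 * n - 2 * k) + 2)"
    by (intro sum.cong) auto
  also have "\<dots> = (\<Sum>k\<in>{1..<Suc n}. 2 * n - 2 * k) + 2 * n"
    unfolding sum.distrib by simp
  also have "(\<Sum>k\<in>{1..<Suc n}. 2 * n - 2 * k) = (\<Sum>k\<in>{1..<n}. 2 * n - 2 * k)"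
    by (cases n) simp_all
  finally show ?case
    using Suc by (cases n) simp_all
qed simp

lemma card_avoiders:
  "card (dumont4_avoiding n 4 (one_line [1, 3, 2, 4])) = n * (n - 1) + 1"
proof -
  let ?F = "\<lambda>(k, j). max_at (2 * n) (2 * k) j"
  let ?I = "SIGMA k:{1..<n}. {2 * k..<2 * n}"
  have "inj_on ?F ?I"
    by (rule inj_onI) (auto dest!: max_at_inj)
  then have "card (?F ` ?I) = card ?I"
    by (rule card_image)
  also have "\<dots> = n * (n - 1)"
    using sum_even_differences[of n] by simp
  finally have "card (?F ` ?I) = n * (n - 1)" .
  moreover have "id \<notin> ?F ` ?I"
  proof
    assume "id \<in> ?F ` ?I"
    then obtain k j where "2 * k \<le> j" "j < 2 * n" and eq: "id = max_at (2 * n) (2 * k) j"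
      by auto
    then show False
      using fun_cong[OF eq, of "2 * n"] unfolding max_at_def id_def by simp
  qed
  ultimately show ?thesis
    unfolding avoiders_eq by (subst card_insert_disjoint) auto
qed

theorem theorem3p7:
  fixes n :: nat
  shows "card (dumont4_avoiding n 4 (one_line [1, 3, 2, 4])) = 2 * (n choose 2) + 1
    \<and> int (card (dumont4_avoiding n 4 (one_line [1, 3, 2, 4]))) = (int n)\<^sup>2 - int n + 1"
proof
  have "even (n * (n - 1))"
    by (cases n) auto
  then show "card (dumont4_avoiding n 4 (one_line [1, 3, 2, 4])) = 2 * (n choose 2) + 1"
    unfolding card_avoiders choose_two by simp
  show "int (card (dumont4_avoiding n 4 (one_line [1, 3, 2, 4]))) = (int n)\<^sup>2 - int n + 1"
    unfolding card_avoiders by (cases n) (simp_all add: power2_eq_square algebra_simps)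
qed

end
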